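(* Let $\{\phi_t\}_{t\in\mathbb{R}}$ be an additive flow given by its special representation on a space $Y\times[0,r(\cdot))=\{(y,u):y\in Y,\ 0\le u<r(y)\}$ with maps $V$ and $r$, i.e. $$\phi_t(y,u)=(V^ny,\,t+u-r_n(y))\quad\text{for }0\le t+u-r_n(y)<r(V^ny),\ n\in\mathbb{Z}.$$ Let $\{A_t\}_{t\in\mathbb{R}}$ be a cocycle for $\{\phi_t\}_{t\in\mathbb{R}}$ taking values in $\mathbb{R}\setminus\{0\}$, and let $\{F_t\}_{t\in\mathbb{R}}$ be a semi-additive functional related to the cocycle $\{A_t\}_{t\in\mathbb{R}}$. Then there are functions $f:Y\times[0,r(\cdot))\to\mathbb{R}$ and $f_1:Y\to\mathbb{R}$ such that $$F_t(y,u)=F^{(1)}_t(y,u)+F^{(2)}_t(y,u)$$ for all $t\in\mathbb{R}$ and $(y,u)\in Y\times[0,r(\cdot))$, where $$F^{(1)}_t(y,u)=A_t(y,u)\,f(\phi_t(y,u))-f(y,u),$$ $$F^{(2)}_t(y,u)=(A_u(y,0))^{-1}\sum_{k\in[0,n)}A_{r_k(y)}(y,0)\,f_1(V^ky)\quad\text{for }r_n(y)\le t+u<r_{n+1}(y).$$ Moreover, each of $\{F^{(1)}_t\}_{t\in\mathbb{R}}$ and $\{F^{(2)}_t\}_{t\in\mathbb{R}}$ is a semi-additive functional related to the cocycle $\{A_t\}_{t\in\mathbb{R}}$.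
   Context: Special representation: $(Y,\mathcal{Y},\tau)$ is a standard Lebesgue space (standard Borel space with a $\sigma$-finite measure); $V$ is a null-isomorphism of $Y$ onto itself (a one-to-one, onto, bimeasurable map such that $\tau$ and $\tau\circ V$ have the same null sets); $r$ is a positive measurable function on $Y$ with $\sum_{k=-\infty}^{-1}r(V^ky)=\sum_{k=0}^\infty r(V^ky)=\infty$; and $r_n(y)=\sum_{k=0}^{n-1}r(V^ky)$ for $n\ge1$, $r_0(y)=0$, $r_n(y)=-\sum_{k=n}^{-1}r(V^ky)$ for $n\le-1$. The space $Y\times[0,r(\cdot))$ carries the measure $\tau(dy)du$. Convention: $\sum_{k\in[0,n)}a_k=\sum_{k=0}^{n-1}a_k$ for $n\ge1$, $=0$ for $n=0$, and $=-\sum_{k=n}^{-1}a_k$ for $n\le-1$. A cocycle for the flow with values in $\mathbb{R}\setminus\{0\}$ is a measurable map $(t,x)\mapsto A_t(x)\in\mathbb{R}\setminus\{0\}$ on $\mathbb{R}\times X$ (here $X=Y\times[0,r(\cdot))$) with $A_{t_1+t_2}(x)=A_{t_1}(x)A_{t_2}(\phi_{t_1}(x))$ for all $t_1,t_2\in\mathbb{R}$, $x\in X$. A measurable map $(t,x)\mapsto F_t(x)\in\mathbb{R}$ on $\mathbb{R}\times X$ is a semi-additive functional related to the cocycle $\{A_t\}$ (and the flow) if $F_{t_1+t_2}(x)=F_{t_1}(x)+A_{t_1}(x)F_{t_2}(\phi_{t_1}(x))$ for all $t_1,t_2\in\mathbb{R}$, $x\in X$. *)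

theory Defs
  imports "HOL-Analysis.Analysis"
begin

text \<open>
  The underlying set is \<^term>\<open>space M\<close>, which need not be a whole type, so the Polish topology is
  an abstract one.
\<close>

definition standard_borel :: "'a measure \<Rightarrow> bool" where
  "standard_borel M \<longleftrightarrow>
     (\<exists>T. topspace T = space M \<and> completely_metrizable_space T \<and> second_countable T \<and>
          sets M = sigma_sets (space M) {U. openin T U})"

definition standard_lebesgue_space :: "'a measure \<Rightarrow> bool" where
  "standard_lebesgue_space M \<longleftrightarrow> standard_borel M \<and> sigma_finite_measure M"

definition null_isomorphism :: "'a measure \<Rightarrow> ('a \<Rightarrow> 'a) \<Rightarrow> bool" where
  "null_isomorphism M V \<longleftrightarrow>
     bij_betw V (space M) (space M) \<and>
     V \<in> measurable M M \<and> inv_into (space M) V \<in> measurable M M \<and>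
     (\<forall>B\<in>sets M. emeasure M B = 0 \<longleftrightarrow> emeasure M (V ` B) = 0)"

definition int_iter :: "'a set \<Rightarrow> ('a \<Rightarrow> 'a) \<Rightarrow> int \<Rightarrow> 'a \<Rightarrow> 'a" where
  "int_iter Y V k =
     (if 0 \<le> k then V ^^ nat k else inv_into Y V ^^ nat (- k))"

text \<open>
  The signed sum over the interval from \<open>0\<close> to \<open>n\<close>, also for negative \<open>n\<close>.
\<close>

definition signed_sum :: "(int \<Rightarrow> real) \<Rightarrow> int \<Rightarrow> real" where
  "signed_sum a n = (if 0 \<le> n then (\<Sum>k\<in>{0..<n}. a k) else - (\<Sum>k\<in>{n..-1}. a k))"

definition partial_r :: "'a set \<Rightarrow> ('a \<Rightarrow> 'a) \<Rightarrow> ('a \<Rightarrow> real) \<Rightarrow> int \<Rightarrow> 'a \<Rightarrow> real" where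
  "partial_r Y V r n y = signed_sum (\<lambda>k. r (int_iter Y V k y)) n"

locale special_representation =
  fixes \<tau> :: "'a measure" and V :: "'a \<Rightarrow> 'a" and r :: "'a \<Rightarrow> real"
  assumes standard: "standard_lebesgue_space \<tau>"
    and null_iso: "null_isomorphism \<tau> V"
    and r_measurable: "r \<in> borel_measurable \<tau>"
    and r_pos: "\<And>y. y \<in> space \<tau> \<Longrightarrow> 0 < r y"
    and r_sum_neg: "\<And>y. y \<in> space \<tau> \<Longrightarrow>
          (\<Sum>k. ennreal (r (int_iter (space \<tau>) V (- int (Suc k)) y))) = \<infinity>"
    and r_sum_nonneg: "\<And>y. y \<in> space \<tau> \<Longrightarrow>
          (\<Sum>k. ennreal (r (int_iter (space \<tau>) V (int k) y))) = \<infinity>"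

definition under_graph :: "'a measure \<Rightarrow> ('a \<Rightarrow> real) \<Rightarrow> ('a \<times> real) measure" where
  "under_graph \<tau> r =
     restrict_space (\<tau> \<Otimes>\<^sub>M lborel) {(y, u). y \<in> space \<tau> \<and> 0 \<le> u \<and> u < r y}"

definition additive_flow :: "'x measure \<Rightarrow> (real \<Rightarrow> 'x \<Rightarrow> 'x) \<Rightarrow> bool" where
  "additive_flow X \<phi> \<longleftrightarrow>
     (\<lambda>(t, x). \<phi> t x) \<in> measurable (borel \<Otimes>\<^sub>M X) X \<and>
     (\<forall>x\<in>space X. \<phi> 0 x = x) \<and>
     (\<forall>t1 t2. \<forall>x\<in>space X. \<phi> (t1 + t2) x = \<phi> t1 (\<phi> t2 x))"

definition given_by_special_representation ::
  "'a measure \<Rightarrow> ('a \<Rightarrow> 'a) \<Rightarrow> ('a \<Rightarrow> real) \<Rightarrow> (real \<Rightarrow> 'a \<times> real \<Rightarrow> 'a \<times> real) \<Rightarrow> bool" where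
  "given_by_special_representation \<tau> V r \<phi> \<longleftrightarrow>
     (\<forall>t y u n. (y, u) \<in> space (under_graph \<tau> r) \<longrightarrow>
        0 \<le> t + u - partial_r (space \<tau>) V r n y \<longrightarrow>
        t + u - partial_r (space \<tau>) V r n y < r (int_iter (space \<tau>) V n y) \<longrightarrow>
        \<phi> t (y, u) = (int_iter (space \<tau>) V n y, t + u - partial_r (space \<tau>) V r n y))"

definition cocycle :: "'x measure \<Rightarrow> (real \<Rightarrow> 'x \<Rightarrow> 'x) \<Rightarrow> (real \<Rightarrow> 'x \<Rightarrow> real) \<Rightarrow> bool" where
  "cocycle X \<phi> A \<longleftrightarrow>
     (\<lambda>(t, x). A t x) \<in> borel_measurable (borel \<Otimes>\<^sub>M X) \<and>
     (\<forall>t. \<forall>x\<in>space X. A t x \<noteq> 0) \<and>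
     (\<forall>t1 t2. \<forall>x\<in>space X. A (t1 + t2) x = A t1 x * A t2 (\<phi> t1 x))"

definition semi_additive_functional ::
  "'x measure \<Rightarrow> (real \<Rightarrow> 'x \<Rightarrow> 'x) \<Rightarrow> (real \<Rightarrow> 'x \<Rightarrow> real) \<Rightarrow> (real \<Rightarrow> 'x \<Rightarrow> real) \<Rightarrow> bool" where
  "semi_additive_functional X \<phi> A F \<longleftrightarrow>
     (\<lambda>(t, x). F t x) \<in> borel_measurable (borel \<Otimes>\<^sub>M X) \<and>
     (\<forall>t1 t2. \<forall>x\<in>space X. F (t1 + t2) x = F t1 x + A t1 x * F t2 (\<phi> t1 x))"

lemma partial_r_Suc:
  "partial_r Y V r (n + 1) y = partial_r Y V r n y + r (int_iter Y V n y)"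
proof -
  consider "0 \<le> n" | "n = -1" | "n < -1" by linarith
  then show ?thesis
  proof cases
    case 1
    then have "{0..<n + 1} = insert n {0..<n}" by auto
    with 1 show ?thesis by (simp add: partial_r_def signed_sum_def)
  next
    case 2
    then show ?thesis by (simp add: partial_r_def signed_sum_def)
  next
    case 3
    then have "{n..-1} = insert n {n + 1..-1}" by auto
    with 3 show ?thesis by (simp add: partial_r_def signed_sum_def)
  qed
qed

context special_representation
begin

lemma int_iter_in_space: "y \<in> space \<tau> \<Longrightarrow> int_iter (space \<tau>) V k y \<in> space \<tau>"
proof -
  assume y: "y \<in> space \<tau>"
  have bij: "bij_betw V (space \<tau>) (space \<tau>)" using null_iso by (simp add: null_isomorphism_def)
  have "(V ^^ m) y \<in> space \<tau>" for m
    using y bij by (induction m) (auto simp: bij_betw_def)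
  moreover have "(inv_into (space \<tau>) V ^^ m) y \<in> space \<tau>" for m
    using y bij_betw_inv_into[OF bij] by (induction m) (auto simp: bij_betw_def)
  ultimately show ?thesis by (simp add: int_iter_def)
qed

lemma partial_r_strict_mono:
  assumes "y \<in> space \<tau>" "m < n"
  shows "partial_r (space \<tau>) V r m y < partial_r (space \<tau>) V r n y"
  using assms(2)
proof (induction n rule: int_gr_induct)
  case base
  then show ?case using r_pos[OF int_iter_in_space[OF assms(1)]] by (simp add: partial_r_Suc)
next
  case (step i)
  then show ?case using r_pos[OF int_iter_in_space[OF assms(1), of i]] by (simp add: partial_r_Suc)
qed

lemma unbounded_of_suminf:
  fixes a :: "nat \<Rightarrow> real"
  assumes "\<And>k. 0 \<le> a k" and "(\<Sum>k. ennreal (a k)) = \<infinity>"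
  shows "\<exists>n. B < sum a {..<n}"
proof (rule ccontr)
  assume "\<not> ?thesis"
  then have "sum a {..<n} \<le> B" for n by (simp add: not_less)
  then have "(\<Sum>k<n. ennreal (a k)) \<le> ennreal B" for n
    using assms(1) by (simp add: ennreal_leI)
  then have "(\<Sum>k. ennreal (a k)) \<le> ennreal B" by (intro suminf_le_const) auto
  with assms(2) show False by (simp add: top_unique)
qed

text \<open>
  So the case distinctions over \<open>n\<close> for the flow and for the functional always have exactly one
  applicable case.
\<close>

lemma ex1_level:
  assumes y: "y \<in> space \<tau>"
  shows "\<exists>!n. partial_r (space \<tau>) V r n y \<le> s \<and> s < partial_r (space \<tau>) V r (n + 1) y"
proof -
  let ?p = "\<lambda>n. partial_r (space \<tau>) V r n y"
  have nn: "0 \<le> r (int_iter (space \<tau>) V k y)" for k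
    using r_pos[OF int_iter_in_space[OF y]] by (simp add: less_imp_le)
  have up: "?p (int n) = (\<Sum>k<n. r (int_iter (space \<tau>) V (int k) y))" for n
  proof (induction n)
    case 0
    show ?case by (simp add: partial_r_def signed_sum_def)
  next
    case (Suc n)
    then show ?case using partial_r_Suc[of "space \<tau>" V r "int n" y] by (simp add: add.commute)
  qed
  have dn: "?p (- int n) = - (\<Sum>k<n. r (int_iter (space \<tau>) V (- int (Suc k)) y))" for n
  proof (induction n)
    case 0
    show ?case by (simp add: partial_r_def signed_sum_def)
  next
    case (Suc n)
    then show ?case using partial_r_Suc[of "space \<tau>" V r "- int (Suc n)" y] by simp
  qed
  obtain N where N: "s < ?p (int N)"
    using unbounded_of_suminf[OF nn r_sum_nonneg[OF y], of s] up by auto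
  obtain M where "- s < (\<Sum>k<M. r (int_iter (space \<tau>) V (- int (Suc k)) y))"
    using unbounded_of_suminf[OF nn r_sum_neg[OF y], of "- s"] by blast
  then have M: "?p (- int M) < s" unfolding dn by linarith
  define P where "P j \<longleftrightarrow> s < ?p (- int M + int j)" for j
  have "P (N + M)" using N by (simp add: P_def)
  moreover have "\<not> P 0" using M by (simp add: P_def)
  ultimately obtain j where j: "\<not> P j" "P (Suc j)"
    using ex_least_nat_less[of P "N + M"] by auto
  show ?thesis
  proof (rule ex1I)
    show "?p (- int M + int j) \<le> s \<and> s < ?p (- int M + int j + 1)"
      using j by (simp add: P_def not_less add_ac)
  next
    fix n assume n: "?p n \<le> s \<and> s < ?p (n + 1)"
    have m: "?p (- int M + int j) \<le> s" "s < ?p (- int M + int j + 1)"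
      using j by (simp_all add: P_def not_less add_ac)
    have le: "?p a \<le> ?p b" if "a \<le> b" for a b
      using partial_r_strict_mono[OF y, of a b] that by (cases "a = b") auto
    show "n = - int M + int j"
      using n m le[of "n + 1" "- int M + int j"] le[of "- int M + int j + 1" n] by linarith
  qed
qed

end

end

theory Submission
  imports Defs
begin

text \<open>
  Every point is \<open>(y, u) = \<phi>\<^sub>u (y, 0)\<close>, so semi-additivity expresses \<open>F\<^sub>t (y, u)\<close> through
  \<open>F\<^sub>t\<^sub>+\<^sub>u (y, 0)\<close> and \<open>F\<^sub>u (y, 0)\<close>. Splitting the time \<open>t + u\<close> at the last visit \<open>r\<^sub>n(y)\<close> to the base,
  the complete excursions contribute the sum of \<open>f\<^sub>1(y) = F\<^bsub>r(y)\<^esub> (y, 0)\<close> along the orbit of \<open>V\<close>, and the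
  two incomplete ones combine to the coboundary of \<open>f (y, u) = F\<^sub>u (y, 0) / A\<^sub>u (y, 0)\<close>.
\<close>

section \<open>Signed sums over integer intervals\<close>

lemma signed_sum_0 [simp]: "signed_sum a 0 = 0"
  by (simp add: signed_sum_def)

text \<open>The minus sign for negative \<open>n\<close> makes one recursion hold on all integers.
  The case \<open>n = -1\<close> is separate because there \<open>n\<close> and \<open>n + 1\<close>
  fall into different branches of the definition.\<close>

lemma signed_sum_add_1: "signed_sum a (n + 1) = signed_sum a n + a n"
proof -
  consider "0 \<le> n" | "n = -1" | "n < -1" by linarith
  then show ?thesis
  proof cases
    case 1
    then have "{0..<n + 1} = insert n {0..<n}" by auto
    with 1 show ?thesis by (simp add: signed_sum_def)
  next
    case 2
    then show ?thesis by (simp add: signed_sum_def)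
  next
    case 3
    then have "{n..-1} = insert n {n + 1..-1}" by auto
    with 3 show ?thesis by (simp add: signed_sum_def)
  qed
qed

text \<open>A function on the integers is determined by its increments and its value at
  \<open>0\<close>, so negative \<open>n\<close> needs no separate argument later.\<close>

lemma signed_sum_eqI:
  assumes "g 0 = 0" and "\<And>n. g (n + 1) = g n + a n"
  shows "g n = signed_sum a n"
proof (induction n rule: int_induct[where k = 0])
  case base
  show ?case by (simp add: assms(1))
next
  case (step1 i)
  then show ?case by (simp add: assms(2) signed_sum_add_1)
next
  case (step2 i)
  \<comment> \<open>Downwards, the recursion at \<open>i - 1\<close> is solved for
    \<open>g (i - 1)\<close>.\<close>
  then show ?case using assms(2)[of "i - 1"] signed_sum_add_1[of a "i - 1"] by simp
qed

lemma partial_r_0 [simp]: "partial_r Y V r 0 y = 0"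
  by (simp add: partial_r_def)

lemma int_iter_0 [simp]: "int_iter Y V 0 y = y"
  by (simp add: int_iter_def)

lemma space_under_graph:
  "space (under_graph \<tau> r) = {(y, u). y \<in> space \<tau> \<and> 0 \<le> u \<and> u < r y}"
  by (auto simp: under_graph_def space_restrict_space space_pair_measure)

section \<open>Flows, cocycles and semi-additive functionals\<close>

lemma additive_flow_add:
  assumes "additive_flow X \<phi>" "x \<in> space X"
  shows "\<phi> (s + t) x = \<phi> t (\<phi> s x)"
  \<comment> \<open>The definition lets \<open>t2\<close> act first; commuting the times matches the
    order in the cocycle identity.\<close>
  using assms by (metis additive_flow_def add.commute)

lemma additive_flow_measurable:
  assumes "additive_flow X \<phi>"
  shows "(\<lambda>(t, x). \<phi> t x) \<in> measurable (borel \<Otimes>\<^sub>M X) X"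
  using assms by (simp add: additive_flow_def)

lemma cocycle_add:
  assumes "cocycle X \<phi> A" "x \<in> space X"
  shows "A (s + t) x = A s x * A t (\<phi> s x)"
  using assms by (simp add: cocycle_def)

lemma cocycle_nonzero:
  assumes "cocycle X \<phi> A" "x \<in> space X"
  shows "A t x \<noteq> 0"
  using assms by (simp add: cocycle_def)

lemma cocycle_measurable:
  assumes "cocycle X \<phi> A"
  shows "(\<lambda>(t, x). A t x) \<in> borel_measurable (borel \<Otimes>\<^sub>M X)"
  using assms by (simp add: cocycle_def)

lemma semi_additive_functional_add:
  assumes "semi_additive_functional X \<phi> A F" "x \<in> space X"
  shows "F (s + t) x = F s x + A s x * F t (\<phi> s x)"
  using assms by (simp add: semi_additive_functional_def)

lemma semi_additive_functional_measurable:
  assumes "semi_additive_functional X \<phi> A F"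
  shows "(\<lambda>(t, x). F t x) \<in> borel_measurable (borel \<Otimes>\<^sub>M X)"
  using assms by (simp add: semi_additive_functional_def)

text \<open>Taking both times \<open>0\<close> gives \<open>F 0 x = F 0 x + A 0 x * F 0 x\<close>,
  and \<open>A 0 x\<close> does not vanish.\<close>

lemma semi_additive_functional_0:
  assumes "additive_flow X \<phi>" "cocycle X \<phi> A" "semi_additive_functional X \<phi> A F" "x \<in> space X"
  shows "F 0 x = 0"
proof -
  have "\<phi> 0 x = x" using assms(1,4) by (simp add: additive_flow_def)
  then show ?thesis
    using semi_additive_functional_add[OF assms(3,4), of 0 0] cocycle_nonzero[OF assms(2,4), of 0]
    by simp
qed

text \<open>For fixed \<open>A\<close> the defining identity is linear in the functional.\<close>

lemma semi_additive_functional_diff: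
  assumes F: "semi_additive_functional X \<phi> A F" and G: "semi_additive_functional X \<phi> A G"
  shows "semi_additive_functional X \<phi> A (\<lambda>t x. F t x - G t x)"
  unfolding semi_additive_functional_def
proof (intro conjI allI ballI)
  show "(\<lambda>(t, x). F t x - G t x) \<in> borel_measurable (borel \<Otimes>\<^sub>M X)"
    using borel_measurable_diff[OF F[THEN semi_additive_functional_measurable]
        G[THEN semi_additive_functional_measurable]]
    by (simp add: case_prod_beta)
next
  fix s t x assume x: "x \<in> space X"
  show "F (s + t) x - G (s + t) x = F s x - G s x + A s x * (F t (\<phi> s x) - G t (\<phi> s x))"
    by (simp add: semi_additive_functional_add[OF F x] semi_additive_functional_add[OF G x]
        algebra_simps)
qed

text \<open>The identity telescopes: once \<open>A (s + t) x\<close> is factored, the two terms with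
  \<open>f (\<phi> s x)\<close> cancel.\<close>

lemma semi_additive_functional_coboundary:
  assumes \<phi>: "additive_flow X \<phi>" and A: "cocycle X \<phi> A" and f: "f \<in> borel_measurable X"
  shows "semi_additive_functional X \<phi> A (\<lambda>t x. A t x * f (\<phi> t x) - f x)"
  unfolding semi_additive_functional_def
proof (intro conjI allI ballI)
  have "(\<lambda>p. f (\<phi> (fst p) (snd p))) \<in> borel_measurable (borel \<Otimes>\<^sub>M X)"
    using measurable_compose[OF additive_flow_measurable[OF \<phi>] f] by (simp add: case_prod_beta)
  moreover have "(\<lambda>p. A (fst p) (snd p)) \<in> borel_measurable (borel \<Otimes>\<^sub>M X)"
    using cocycle_measurable[OF A] by (simp add: case_prod_beta)
  moreover have "(\<lambda>p. f (snd p)) \<in> borel_measurable (borel \<Otimes>\<^sub>M X)"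
    by (rule measurable_compose[OF measurable_snd f])
  ultimately show "(\<lambda>(t, x). A t x * f (\<phi> t x) - f x) \<in> borel_measurable (borel \<Otimes>\<^sub>M X)"
    unfolding case_prod_beta by (intro borel_measurable_diff borel_measurable_times)
next
  fix s t x assume x: "x \<in> space X"
  show "A (s + t) x * f (\<phi> (s + t) x) - f x =
    A s x * f (\<phi> s x) - f x + A s x * (A t (\<phi> s x) * f (\<phi> t (\<phi> s x)) - f (\<phi> s x))"
    by (simp add: cocycle_add[OF A x] additive_flow_add[OF \<phi> x] algebra_simps)
qed

section \<open>Motion from the base of the special representation\<close>

context special_representation
begin

lemma base_in_space_under_graph: "y \<in> space \<tau> \<Longrightarrow> (y, 0) \<in> space (under_graph \<tau> r)"
  by (simp add: space_under_graph r_pos)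

text \<open>This is \<open>G\<close> composed with the measurable map sending \<open>(y, u)\<close>
  to \<open>(u, (y, 0))\<close>. Applied to \<open>F\<close> and \<open>A\<close>, it makes
  \<open>f\<close> measurable.\<close>

lemma measurable_along_fibre:
  assumes "(\<lambda>(t, x). G t x) \<in> borel_measurable (borel \<Otimes>\<^sub>M under_graph \<tau> r)"
  shows "(\<lambda>(y, u). G u (y, 0)) \<in> borel_measurable (under_graph \<tau> r)"
proof -
  have id: "(\<lambda>x. x) \<in> measurable (under_graph \<tau> r) (\<tau> \<Otimes>\<^sub>M lborel)"
    unfolding under_graph_def by (rule measurable_restrict_space1) simp
  have fst: "fst \<in> measurable (under_graph \<tau> r) \<tau>"
    using measurable_compose[OF id measurable_fst] by simp
  have snd: "snd \<in> measurable (under_graph \<tau> r) borel"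
    using measurable_compose[OF id measurable_snd] by simp
  have "(\<lambda>x. (fst x, 0)) \<in> measurable (under_graph \<tau> r) (under_graph \<tau> r)"
    \<comment> \<open>Only the target is unfolded: it remains to map measurably into the product and
      to stay below the graph, which holds since \<open>0 < r y\<close>.\<close>
    by (subst (2) under_graph_def, intro measurable_restrict_space2 measurable_Pair fst)
      (auto simp: space_under_graph r_pos)
  from measurable_compose[OF measurable_Pair[OF snd this] assms]
  show ?thesis by (simp add: case_prod_beta)
qed

lemma flow_from_base:
  assumes "given_by_special_representation \<tau> V r \<phi>" "y \<in> space \<tau>"
    and "0 \<le> v" "v < r (int_iter (space \<tau>) V n y)"
  shows "\<phi> (partial_r (space \<tau>) V r n y + v) (y, 0) = (int_iter (space \<tau>) V n y, v)"
proof -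
  have "\<forall>t u n. (y, u) \<in> space (under_graph \<tau> r) \<longrightarrow> 0 \<le> t + u - partial_r (space \<tau>) V r n y \<longrightarrow>
      t + u - partial_r (space \<tau>) V r n y < r (int_iter (space \<tau>) V n y) \<longrightarrow>
      \<phi> t (y, u) = (int_iter (space \<tau>) V n y, t + u - partial_r (space \<tau>) V r n y)"
    using assms(1) unfolding given_by_special_representation_def by blast
  \<comment> \<open>Unknowns are instantiated in order of first occurrence, so \<open>0\<close> is
    the starting height \<open>u\<close> and the next argument is the time \<open>t\<close>.\<close>
  from this[rule_format, of 0 "partial_r (space \<tau>) V r n y + v" n] show ?thesis
    using assms(3,4) base_in_space_under_graph[OF assms(2)] by simp
qed

text \<open>At the return time with index \<open>n\<close> the flow from \<open>(y, 0)\<close> is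
  again on the base, so the next complete excursion adds exactly one summand.\<close>

lemma functional_at_return_time:
  assumes \<phi>: "additive_flow (under_graph \<tau> r) \<phi>"
    and rep: "given_by_special_representation \<tau> V r \<phi>"
    and A: "cocycle (under_graph \<tau> r) \<phi> A"
    and F: "semi_additive_functional (under_graph \<tau> r) \<phi> A F"
    and y: "y \<in> space \<tau>"
  shows "F (partial_r (space \<tau>) V r n y) (y, 0) =
    signed_sum (\<lambda>k. A (partial_r (space \<tau>) V r k y) (y, 0) *
      F (r (int_iter (space \<tau>) V k y)) (int_iter (space \<tau>) V k y, 0)) n"
proof (rule signed_sum_eqI)
  note x = base_in_space_under_graph[OF y]
  show "F (partial_r (space \<tau>) V r 0 y) (y, 0) = 0"
    by (simp add: semi_additive_functional_0[OF \<phi> A F x])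
  fix n
  have "\<phi> (partial_r (space \<tau>) V r n y) (y, 0) = (int_iter (space \<tau>) V n y, 0)"
    using flow_from_base[OF rep y, of 0 n] r_pos[OF int_iter_in_space[OF y]] by simp
  then show "F (partial_r (space \<tau>) V r (n + 1) y) (y, 0) = F (partial_r (space \<tau>) V r n y) (y, 0) +
      A (partial_r (space \<tau>) V r n y) (y, 0) *
        F (r (int_iter (space \<tau>) V n y)) (int_iter (space \<tau>) V n y, 0)"
    by (simp add: partial_r_Suc semi_additive_functional_add[OF F x])
qed

text \<open>The time \<open>u + t\<close> from \<open>(y, 0)\<close> is split both at
  \<open>u\<close> and at the last return to the base. Comparing the two splittings determines
  \<open>A t (y, u)\<close> and \<open>F t (y, u)\<close>.\<close>

lemma functional_decomposition:
  fixes A F :: "real \<Rightarrow> 'a \<times> real \<Rightarrow> real"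
  defines "f \<equiv> \<lambda>(y, u). F u (y, 0) / A u (y, 0)"
  assumes \<phi>: "additive_flow (under_graph \<tau> r) \<phi>"
    and rep: "given_by_special_representation \<tau> V r \<phi>"
    and A: "cocycle (under_graph \<tau> r) \<phi> A"
    and F: "semi_additive_functional (under_graph \<tau> r) \<phi> A F"
    and yu: "(y, u) \<in> space (under_graph \<tau> r)"
    and n: "partial_r (space \<tau>) V r n y \<le> t + u" "t + u < partial_r (space \<tau>) V r (n + 1) y"
  shows "F t (y, u) - (A t (y, u) * f (\<phi> t (y, u)) - f (y, u)) =
    inverse (A u (y, 0)) * F (partial_r (space \<tau>) V r n y) (y, 0)"
proof -
  \<comment> \<open>\<open>v\<close> is the height at which \<open>\<phi> t (y, u)\<close> lies
    above the base.\<close>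
  define v where "v = t + u - partial_r (space \<tau>) V r n y"
  let ?R = "partial_r (space \<tau>) V r n y" and ?y = "int_iter (space \<tau>) V n y"
  have y: "y \<in> space \<tau>" and u: "0 \<le> u" "u < r y" using yu by (auto simp: space_under_graph)
  note x = base_in_space_under_graph[OF y]
  have v: "0 \<le> v" "v < r ?y" using n by (simp_all add: v_def partial_r_Suc)
  have ut: "u + t = ?R + v" by (simp add: v_def)
  have \<phi>u: "\<phi> u (y, 0) = (y, u)" using flow_from_base[OF rep y, of u 0] u by simp
  have \<phi>R: "\<phi> ?R (y, 0) = (?y, 0)"
    using flow_from_base[OF rep y, of 0 n] r_pos[OF int_iter_in_space[OF y]] by simp
  have \<phi>t: "\<phi> t (y, u) = (?y, v)"
    using additive_flow_add[OF \<phi> x, of u t] flow_from_base[OF rep y v] by (simp add: ut \<phi>u)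
  have Aut: "A u (y, 0) * A t (y, u) = A ?R (y, 0) * A v (?y, 0)"
    using cocycle_add[OF A x, of u t] cocycle_add[OF A x, of ?R v] by (simp add: ut \<phi>u \<phi>R)
  have Fut: "F u (y, 0) + A u (y, 0) * F t (y, u) = F ?R (y, 0) + A ?R (y, 0) * F v (?y, 0)"
    using semi_additive_functional_add[OF F x, of u t] semi_additive_functional_add[OF F x, of ?R v]
    by (simp add: ut \<phi>u \<phi>R)
  have A0: "A u (y, 0) \<noteq> 0" "A v (?y, 0) \<noteq> 0"
    using cocycle_nonzero[OF A] x base_in_space_under_graph[OF int_iter_in_space[OF y]] by auto
  have At: "A t (y, u) = A ?R (y, 0) * A v (?y, 0) / A u (y, 0)"
    using Aut A0 by (simp add: field_simps)
  have Ft: "F t (y, u) = (F ?R (y, 0) + A ?R (y, 0) * F v (?y, 0) - F u (y, 0)) / A u (y, 0)"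
    using Fut A0 by (simp add: field_simps)
  \<comment> \<open>In \<open>A t (y, u) * f (\<phi> t (y, u))\<close> the factor
    \<open>A v (?y, 0)\<close> cancels, so the contributions of both incomplete excursions
    disappear.\<close>
  show ?thesis using A0 by (simp add: f_def \<phi>t At Ft field_simps)
qed

end

theorem corollary2p2:
  fixes \<tau> :: "'a measure" and V :: "'a \<Rightarrow> 'a" and r :: "'a \<Rightarrow> real"
    and \<phi> :: "real \<Rightarrow> 'a \<times> real \<Rightarrow> 'a \<times> real"
    and A F :: "real \<Rightarrow> 'a \<times> real \<Rightarrow> real"
  assumes "special_representation \<tau> V r"
    and "additive_flow (under_graph \<tau> r) \<phi>"
    and "given_by_special_representation \<tau> V r \<phi>"
    and "cocycle (under_graph \<tau> r) \<phi> A"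
    and "semi_additive_functional (under_graph \<tau> r) \<phi> A F"
  shows "\<exists>(f :: 'a \<times> real \<Rightarrow> real) (f1 :: 'a \<Rightarrow> real) F1 F2.
    (\<forall>t. \<forall>(y, u)\<in>space (under_graph \<tau> r). F t (y, u) = F1 t (y, u) + F2 t (y, u)) \<and>
    (\<forall>t. \<forall>(y, u)\<in>space (under_graph \<tau> r).
       F1 t (y, u) = A t (y, u) * f (\<phi> t (y, u)) - f (y, u)) \<and>
    (\<forall>t. \<forall>(y, u)\<in>space (under_graph \<tau> r). \<forall>n::int.
       partial_r (space \<tau>) V r n y \<le> t + u \<and> t + u < partial_r (space \<tau>) V r (n + 1) y \<longrightarrow>
       F2 t (y, u) = inverse (A u (y, 0)) *
         signed_sum (\<lambda>k. A (partial_r (space \<tau>) V r k y) (y, 0) * f1 (int_iter (space \<tau>) V k y)) n) \<and>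
    semi_additive_functional (under_graph \<tau> r) \<phi> A F1 \<and>
    semi_additive_functional (under_graph \<tau> r) \<phi> A F2"
proof -
  interpret special_representation \<tau> V r by fact
  note \<phi> = assms(2) and rep = assms(3) and A = assms(4) and F = assms(5)
  define f where "f = (\<lambda>(y, u). F u (y, 0) / A u (y, 0))"
  define f1 where "f1 = (\<lambda>y. F (r y) (y, 0))"
  define F1 where "F1 = (\<lambda>t x. A t x * f (\<phi> t x) - f x)"
  \<comment> \<open>As a difference, \<open>F2\<close> inherits measurability and semi-additivity;
    its explicit formula is then verified on each level \<open>n\<close>.\<close>
  define F2 where "F2 = (\<lambda>t x. F t x - F1 t x)"
  have "f \<in> borel_measurable (under_graph \<tau> r)"
    using borel_measurable_divide[OF
        measurable_along_fibre[OF semi_additive_functional_measurable[OF F]]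
        measurable_along_fibre[OF cocycle_measurable[OF A]]]
    by (simp add: f_def case_prod_beta)
  then have F1: "semi_additive_functional (under_graph \<tau> r) \<phi> A F1"
    unfolding F1_def by (rule semi_additive_functional_coboundary[OF \<phi> A])
  have F2: "semi_additive_functional (under_graph \<tau> r) \<phi> A F2"
    unfolding F2_def by (rule semi_additive_functional_diff[OF F F1])
  have "F2 t (y, u) = inverse (A u (y, 0)) *
      signed_sum (\<lambda>k. A (partial_r (space \<tau>) V r k y) (y, 0) * f1 (int_iter (space \<tau>) V k y)) n"
    if yu: "(y, u) \<in> space (under_graph \<tau> r)"
      and n: "partial_r (space \<tau>) V r n y \<le> t + u" "t + u < partial_r (space \<tau>) V r (n + 1) y"
    for t y u n
  proof -
    have "y \<in> space \<tau>" using yu by (simp add: space_under_graph)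
    then show ?thesis
      using functional_decomposition[OF \<phi> rep A F yu n] functional_at_return_time[OF \<phi> rep A F]
      by (simp add: F2_def F1_def f_def f1_def)
  qed
  then show ?thesis
    using F1 F2
    by (intro exI[of _ f] exI[of _ f1] exI[of _ F1] exI[of _ F2]) (auto simp: F1_def F2_def)
qed

end
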